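(* Let $K$ be a field of characteristic different from $2$, let $a,d\in K^*$ with $a\neq d$, and let $E_{a,d}$ be the twisted Edwards curve $ax^2+y^2=1+dx^2y^2$ over $K$. Let $P_1=(X_1:Y_1:Z_1)$ and $P_2=(X_2:Y_2:Z_2)$ be two affine, not necessarily distinct, points of $E_{a,d}(K)$. Let $C$ be the conic passing through $\Omega_1=(1:0:0)$, $\Omega_2=(0:1:0)$, $\mathcal{O}'=(0:-1:1)$, $P_1$ and $P_2$, where, if some of these points are equal, $C$ and $E_{a,d}$ are required to intersect with at least that multiplicity at the corresponding point. That is, $C$ is given by an equation $\phi=0$ with $$\phi = c_{Z^2}(Z^2+YZ)+c_{XY}XY+c_{XZ}XZ,\qquad (c_{Z^2}:c_{XY}:c_{XZ})\in\mathbb{P}^2(K).$$ Then the coefficients $c_{Z^2},c_{XY},c_{XZ}$ are uniquely determined up to a common scalar, as follows: (a) If $P_1\neq P_2$, $P_1\neq\mathcal{O}'$ and $P_2\neq\mathcal{O}'$, then $$c_{Z^2}=X_1X_2(Y_1Z_2-Y_2Z_1),$$ $$c_{XY}=Z_1Z_2(X_1Z_2-X_2Z_1+X_1Y_2-X_2Y_1),$$ $$c_{XZ}=X_2Y_2Z_1^2-X_1Y_1Z_2^2+Y_1Y_2(X_2Z_1-X_1Z_2).$$ (b) If $P_1\neq P_2=\mathcal{O}'$, then $$c_{Z^2}=-X_1,\quad c_{XY}=Z_1,\quad c_{XZ}=Z_1.$$ (c) If $P_1=P_2$, then $$c_{Z^2}=X_1Z_1(Z_1-Y_1),\quad c_{XY}=dX_1^2Y_1-Z_1^3,\quad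 c_{XZ}=Z_1(Z_1Y_1-aX_1^2).$$
   Context: The twisted Edwards curve $E_{a,d}$ is regarded as the plane projective quartic $aX^2Z^2+Y^2Z^2=Z^4+dX^2Y^2$ in $\mathbb{P}^2$, with $x=X/Z$, $y=Y/Z$; a point is affine if $Z\neq 0$. Its points at infinity are $\Omega_1=(1:0:0)$ and $\Omega_2=(0:1:0)$, both singular points of multiplicity $2$. The point $\mathcal{O}'=(0,-1)$ has projective coordinates $(0:-1:1)$. A conic means a (possibly degenerate) plane conic defined by a nonzero homogeneous polynomial $\phi\in K[X,Y,Z]$ of degree $2$. A conic passes through $\Omega_1$, $\Omega_2$ and $\mathcal{O}'$ exactly when it has an equation of the form $c_{Z^2}(Z^2+YZ)+c_{XY}XY+c_{XZ}XZ=0$ with $(c_{Z^2}:c_{XY}:c_{XZ})\in\mathbb{P}^2(K)$. (Here $c_{Z^2}$, $c_{XY}$, $c_{XZ}$ are just names of scalars.) Multiplicity convention: at each affine point that occurs $m$ times in the list $\mathcal{O}',P_1,P_2$, the intersection multiplicity of $C$ and $E_{a,d}$ is required to be at least $m$. So it is at least $2$ at $P_1$ if $P_1=P_2\neq\mathcal{O}'$, at least $2$ at $\mathcal{O}'$ if exactly one of $P_1,P_2$ equals $\mathcal{O}'$, and at least $3$ at $\mathcal{O}'$ if $P_1=P_2=\mathcal{O}'$. *)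

theory Defs
  imports
    "HOL-Computational_Algebra.Computational_Algebra"
    "HOL-Library.Extended_Nat"
begin

section \<open>Plane projective curves\<close>

text \<open>
  A polynomial in \<open>K[X,Y,Z]\<close> is represented in \<open>K[X][Y][Z]\<close>, i.e. the innermost
  variable is \<open>X\<close> and the outermost one is \<open>Z\<close>.
\<close>

type_synonym 'a poly3 = "'a poly poly poly"

definition cst :: "'a::field \<Rightarrow> 'a poly3" where
  "cst c = [:[:[:c:]:]:]"

definition varX :: "'a::field poly3" where
  "varX = [:[:[:0, 1:]:]:]"

definition varY :: "'a::field poly3" where
  "varY = [:[:0, 1:]:]"

definition varZ :: "'a::field poly3" where
  "varZ = [:0, 1:]"

definition homogeneous :: "nat \<Rightarrow> 'a::field poly3 \<Rightarrow> bool" where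
  "homogeneous n F \<longleftrightarrow>
     (\<forall>i j k. coeff (coeff (coeff F k) j) i \<noteq> 0 \<longrightarrow> i + j + k = n)"

definition eval2 :: "'a::field poly poly \<Rightarrow> 'a \<times> 'a \<Rightarrow> 'a" where
  "eval2 f P = (case P of (x, y) \<Rightarrow> poly (poly f [:y:]) x)"

definition eval3 :: "'a::field poly3 \<Rightarrow> 'a \<times> 'a \<times> 'a \<Rightarrow> 'a" where
  "eval3 F P = (case P of (x, y, z) \<Rightarrow> eval2 (poly F [:[:z:]:]) (x, y))"

text \<open>
  The point \<open>(X:Y:Z)\<close> of the projective plane is the set of all its homogeneous
  coordinate triples. It is only meaningful if \<open>X\<close>, \<open>Y\<close>, \<open>Z\<close> are not all zero.
\<close>

definition proj_point :: "'a::field \<Rightarrow> 'a \<Rightarrow> 'a \<Rightarrow> ('a \<times> 'a \<times> 'a) set" where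
  "proj_point X Y Z = {(t * X, t * Y, t * Z) | t. t \<noteq> 0}"

definition on_curve :: "('a::field \<times> 'a \<times> 'a) set \<Rightarrow> 'a poly3 \<Rightarrow> bool" where
  "on_curve P F \<longleftrightarrow> (\<forall>v\<in>P. eval3 F v = 0)"

section \<open>Intersection multiplicity at an affine point\<close>

definition dehom :: "'a::field poly3 \<Rightarrow> 'a poly poly" where
  "dehom F = poly F 1"

text \<open>The local ring of the affine plane at \<open>P\<close>, as a subring of \<open>K(x,y)\<close>.\<close>

definition local_ring :: "'a::field \<times> 'a \<Rightarrow> 'a poly poly fract set" where
  "local_ring P = {Fract p q | p q. eval2 q P \<noteq> 0}"

definition local_ideal ::
    "'a::field \<times> 'a \<Rightarrow> 'a poly poly \<Rightarrow> 'a poly poly \<Rightarrow> 'a poly poly fract set" where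
  "local_ideal P f g =
     {u * Fract f 1 + v * Fract g 1 | u v. u \<in> local_ring P \<and> v \<in> local_ring P}"

text \<open>
  The dimension over \<open>K\<close> of the local ring at \<open>P\<close> modulo the ideal generated by the
  dehomogenizations of \<open>F\<close> and \<open>G\<close>: the supremum of the lengths of families in the local
  ring that are linearly independent modulo the ideal (\<open>\<infinity>\<close> if there is no bound).
\<close>

definition intersection_mult :: "'a::field \<times> 'a \<Rightarrow> 'a poly3 \<Rightarrow> 'a poly3 \<Rightarrow> enat" where
  "intersection_mult P F G =
     Sup {enat n | n. \<exists>r :: nat \<Rightarrow> 'a poly poly fract.
       (\<forall>i<n. r i \<in> local_ring P) \<and>
       (\<forall>c :: nat \<Rightarrow> 'a.
          (\<Sum>i<n. Fract [:[:c i:]:] 1 * r i) \<in> local_ideal P (dehom F) (dehom G)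
          \<longrightarrow> (\<forall>i<n. c i = 0))}"

section \<open>Twisted Edwards curves and conics\<close>

definition edwards_curve :: "'a::field \<Rightarrow> 'a \<Rightarrow> 'a poly3" where
  "edwards_curve a d =
     cst a * varX\<^sup>2 * varZ\<^sup>2 + varY\<^sup>2 * varZ\<^sup>2 - varZ ^ 4 - cst d * varX\<^sup>2 * varY\<^sup>2"

definition Omega1 :: "('a::field \<times> 'a \<times> 'a) set" where
  "Omega1 = proj_point 1 0 0"

definition Omega2 :: "('a::field \<times> 'a \<times> 'a) set" where
  "Omega2 = proj_point 0 1 0"

definition Oprime :: "('a::field \<times> 'a \<times> 'a) set" where
  "Oprime = proj_point 0 (- 1) 1"

definition is_conic :: "'a::field poly3 \<Rightarrow> bool" where
  "is_conic \<phi> \<longleftrightarrow> \<phi> \<noteq> 0 \<and> homogeneous 2 \<phi>"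

text \<open>
  The multiplicity condition is vacuous at affine points \<open>(x:y:1)\<close> that do not occur in
  the list, as their count is \<open>0\<close>.
\<close>

definition passes_through_required ::
    "'a::field \<Rightarrow> 'a \<Rightarrow> ('a \<times> 'a \<times> 'a) set \<Rightarrow> ('a \<times> 'a \<times> 'a) set \<Rightarrow> 'a poly3 \<Rightarrow> bool" where
  "passes_through_required a d P1 P2 \<phi> \<longleftrightarrow>
     on_curve Omega1 \<phi> \<and> on_curve Omega2 \<phi> \<and> on_curve Oprime \<phi> \<and>
     on_curve P1 \<phi> \<and> on_curve P2 \<phi> \<and>
     (\<forall>x y. enat (count_list [Oprime, P1, P2] (proj_point x y 1))
              \<le> intersection_mult (x, y) \<phi> (edwards_curve a d))"

definition conic_form :: "'a::field \<Rightarrow> 'a \<Rightarrow> 'a \<Rightarrow> 'a poly3" where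
  "conic_form cZ2 cXY cXZ =
     cst cZ2 * (varZ\<^sup>2 + varY * varZ) + cst cXY * varX * varY + cst cXZ * varX * varZ"

text \<open>
  Existence and uniqueness up to a common scalar: the conics satisfying the requirements
  are exactly the nonzero multiples of the one with the given, not all zero, coefficients.
\<close>

definition conic_determined ::
    "'a::field \<Rightarrow> 'a \<Rightarrow> ('a \<times> 'a \<times> 'a) set \<Rightarrow> ('a \<times> 'a \<times> 'a) set
      \<Rightarrow> 'a \<Rightarrow> 'a \<Rightarrow> 'a \<Rightarrow> bool" where
  "conic_determined a d P1 P2 cZ2 cXY cXZ \<longleftrightarrow>
     (cZ2, cXY, cXZ) \<noteq> (0, 0, 0) \<and>
     (\<forall>\<phi>. is_conic \<phi> \<and> passes_through_required a d P1 P2 \<phi> \<longleftrightarrow>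
        (\<exists>t. t \<noteq> 0 \<and> \<phi> = conic_form (t * cZ2) (t * cXY) (t * cXZ)))"

end

(*
  Lengths of the local ring are bounded from below by a parametrized germ (u, v) in K[t]^2 through
  the point: if t^n divides f(u, v) and g(u, v), then 1, p, ..., p^(n-1) are independent modulo
  (f, g) as soon as p(u, v) = t. They are bounded from above by k as soon as y - y0 and (x - x0)^k
  lie in the local ideal. For a conic c_Z2 (1 + y) + c_XY xy + c_XZ x and the Edwards curve this
  makes every multiplicity requirement a linear condition on (c_Z2, c_XY, c_XZ): multiplicity 2 at
  a point of the curve, which is smooth there, means tangency (germ: the tangent line), and
  multiplicity 3 at O' means c_XY = c_XZ and c_Z2 = 0 (germ: the parabola (t, -1 + (a - d) t^2 / 2)).
  In each case exactly two independent conditions remain, so the conic is their cross product,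
  which is a nonzero multiple of the stated formula.
*)
theory Submission
  imports Defs
begin

section \<open>Intersection multiplicity via parametrized germs\<close>

lemma eval2_simps [simp]:
  "eval2 (f + g) P = eval2 f P + eval2 g P"
  "eval2 (f - g) P = eval2 f P - eval2 g P"
  "eval2 (f * g) P = eval2 f P * eval2 g P"
  "eval2 (f ^ n) P = eval2 f P ^ n"
  "eval2 0 P = 0"
  "eval2 1 P = 1"
  by (simp_all add: eval2_def split: prod.splits)

lemma eval2_prod [simp]: "eval2 (\<Prod>i\<in>A. f i) P = (\<Prod>i\<in>A. eval2 (f i) P)"
  by (simp add: eval2_def poly_prod split: prod.splits)

lemma eval2_nonzero_imp_nonzero: "eval2 q P \<noteq> 0 \<Longrightarrow> q \<noteq> 0"
  by auto

text \<open>Polynomials not vanishing at \<open>P\<close> are units of the local ring, so all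
  denominators can be absorbed into a single factor \<open>h\<close>. Membership thereby becomes a
  polynomial identity, into which a germ can be substituted.\<close>

lemma Fract_mem_local_ideal_iff:
  assumes "eval2 q P \<noteq> 0"
  shows "Fract p q \<in> local_ideal P f g \<longleftrightarrow>
    (\<exists>h A B. eval2 h P \<noteq> 0 \<and> h * p = A * f + B * g)"
proof
  assume "Fract p q \<in> local_ideal P f g"
  then obtain A s B t where st: "eval2 s P \<noteq> 0" "eval2 t P \<noteq> 0"
    and eq: "Fract p q = Fract A s * Fract f 1 + Fract B t * Fract g 1"
    unfolding local_ideal_def local_ring_def by blast
  have nz: "q \<noteq> 0" "s \<noteq> 0" "t \<noteq> 0"
    using assms st by auto
  with eq have "(s * t) * p = (q * A * t) * f + (q * B * s) * g"
    by (simp add: eq_fract algebra_simps)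
  moreover have "eval2 (s * t) P \<noteq> 0" using st by simp
  ultimately show "\<exists>h A B. eval2 h P \<noteq> 0 \<and> h * p = A * f + B * g" by blast
next
  assume "\<exists>h A B. eval2 h P \<noteq> 0 \<and> h * p = A * f + B * g"
  then obtain h A B where h: "eval2 h P \<noteq> 0" and eq: "h * p = A * f + B * g" by blast
  have nz: "q \<noteq> 0" "h \<noteq> 0" using assms h by auto
  have "Fract p q = Fract (h * p) (h * q)"
    using nz by (simp add: eq_fract)
  also have "\<dots> = Fract A (h * q) * Fract f 1 + Fract B (h * q) * Fract g 1"
    using nz by (simp add: eq eq_fract algebra_simps)
  finally have "Fract p q = \<dots>" .
  moreover have "eval2 (h * q) P \<noteq> 0" using assms h by simp
  ultimately show "Fract p q \<in> local_ideal P f g"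
    unfolding local_ideal_def local_ring_def by blast
qed

lemma Fract_sum:
  "(\<Sum>i\<in>I. Fract (f i) (1 :: 'a::idom)) = Fract (\<Sum>i\<in>I. f i) 1"
  by (induction I rule: infinite_finite_induct) (simp_all add: Zero_fract_def)

section \<open>Pullback along a parametrized germ: the ring homomorphism sending x to
  \<open>u\<close> and y to \<open>v\<close>\<close>

definition subst2 :: "'a::field poly \<Rightarrow> 'a poly \<Rightarrow> 'a poly poly \<Rightarrow> 'a poly" where
  "subst2 u v f = poly (map_poly (\<lambda>c. pcompose c u) f) v"

lemma subst2_0 [simp]: "subst2 u v 0 = 0"
  by (simp add: subst2_def)

lemma subst2_pCons [simp]: "subst2 u v (pCons c f) = pcompose c u + v * subst2 u v f"
  by (cases "c = 0 \<and> f = 0") (auto simp: subst2_def map_poly_pCons)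

lemma subst2_1 [simp]: "subst2 u v 1 = 1"
  by (simp add: one_pCons pcompose_pCons)

lemma subst2_add [simp]: "subst2 u v (f + g) = subst2 u v f + subst2 u v g"
  by (induction f g rule: poly_induct2) (simp_all add: pcompose_add algebra_simps)

lemma subst2_smult [simp]: "subst2 u v (smult c f) = pcompose c u * subst2 u v f"
  by (induction f) (simp_all add: pcompose_mult algebra_simps)

lemma subst2_mult [simp]: "subst2 u v (f * g) = subst2 u v f * subst2 u v g"
  by (induction f) (simp_all add: algebra_simps)

lemma subst2_power [simp]: "subst2 u v (f ^ n) = subst2 u v f ^ n"
  by (induction n) simp_all

lemma subst2_sum [simp]: "subst2 u v (\<Sum>i\<in>I. f i) = (\<Sum>i\<in>I. subst2 u v (f i))"
  by (induction I rule: infinite_finite_induct) simp_all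

lemma poly_subst2: "poly (subst2 u v f) t = eval2 f (poly u t, poly v t)"
  by (induction f) (simp_all add: eval2_def poly_pcompose)

section \<open>Lower bounds for the intersection multiplicity\<close>

lemma linear_power_dvd_iff:
  "[:0, 1:] ^ n dvd p \<longleftrightarrow> (\<forall>k<n. coeff p k = 0)" for p :: "'a::field poly"
  using monom_1_dvd_iff'[of n p] by (simp add: monom_altdef)

text \<open>On the germ, \<open>p ^ i\<close> restricts to t^i, and whatever lies in the ideal
  restricts to a multiple of t^n, up to a factor prime to t. A combination of 1, t, ..., t^(n-1)
  that is divisible by t^n is trivial.\<close>

lemma le_intersection_mult:
  assumes f: "[:0, 1:] ^ n dvd subst2 u v (dehom F)"
    and g: "[:0, 1:] ^ n dvd subst2 u v (dehom G)"
    and p: "subst2 u v p = [:0, 1:]"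
  shows "enat n \<le> intersection_mult (poly u 0, poly v 0) F G"
proof -
  let ?P = "(poly u 0, poly v 0)"
  define r where "r i = Fract (p ^ i) 1" for i
  have "c i = 0"
    if mem: "(\<Sum>i<n. Fract [:[:c i:]:] 1 * r i) \<in> local_ideal ?P (dehom F) (dehom G)"
      and "i < n" for c :: "nat \<Rightarrow> 'a" and i
  proof -
    define s where "s = (\<Sum>i<n. [:[:c i:]:] * p ^ i)"
    define w where "w = (\<Sum>i<n. monom (c i) i)"
    have "(\<Sum>i<n. Fract [:[:c i:]:] 1 * r i) = Fract s 1"
      by (simp add: r_def s_def Fract_sum del: mult_pCons_left)
    with mem obtain h A B where h: "eval2 h ?P \<noteq> 0"
      and eq: "h * s = A * dehom F + B * dehom G"
      using Fract_mem_local_ideal_iff[of 1 ?P s] by auto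
    have "subst2 u v s = w"
      by (simp add: s_def w_def p monom_altdef del: mult_pCons_left) simp
    with arg_cong[OF eq, of "subst2 u v"]
    have "subst2 u v h * w = subst2 u v A * subst2 u v (dehom F) + subst2 u v B * subst2 u v (dehom G)"
      by simp
    with f g have dvd: "[:0, 1:] ^ n dvd subst2 u v h * w"
      by (simp only: dvd_add dvd_mult)
    \<comment> \<open>The value at t = 0 is \<open>h\<close> at the point. Hence the pullback of
      \<open>h\<close> has order 0 there, and t^n must divide the other factor
      \<open>w\<close>.\<close>
    have "poly (subst2 u v h) 0 \<noteq> 0"
      using h by (simp add: poly_subst2)
    then have "order 0 (subst2 u v h) = 0" "subst2 u v h \<noteq> 0"
      by (auto simp: order_0I)
    with dvd have "[:0, 1:] ^ n dvd w"
      using order_divides[of 0 n w] order_divides[of 0 n "subst2 u v h * w"]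
      by (auto simp: order_mult)
    then have "coeff w i = 0"
      using \<open>i < n\<close> by (simp add: linear_power_dvd_iff)
    moreover have "coeff w i = c i"
      using \<open>i < n\<close> by (simp add: w_def coeff_sum)
    ultimately show "c i = 0" by simp
  qed
  moreover have "r i \<in> local_ring ?P" for i
    unfolding r_def local_ring_def using eval2_simps(6)[of ?P] by fastforce
  ultimately show ?thesis
    unfolding intersection_mult_def by (intro Sup_upper) blast
qed

section \<open>Upper bounds for the intersection multiplicity, by linear dependence\<close>

lemma exists_nontrivial_linear_relation:
  fixes M :: "'i \<Rightarrow> nat \<Rightarrow> 'a::field"
  assumes "finite S" "k < card S"
  shows "\<exists>c. (\<exists>i\<in>S. c i \<noteq> 0) \<and> (\<forall>j<k. (\<Sum>i\<in>S. c i * M i j) = 0)"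
  using assms
proof (induction k arbitrary: S M)
  case 0
  then have "S \<noteq> {}" by auto
  then show ?case by (intro exI[of _ "\<lambda>_. 1"]) auto
next
  case (Suc k)
  show ?case
  proof (cases "\<forall>i\<in>S. M i k = 0")
    case True
    obtain c where c: "\<exists>i\<in>S. c i \<noteq> 0" "\<forall>j<k. (\<Sum>i\<in>S. c i * M i j) = 0"
      using Suc.IH[of S M] Suc.prems by auto
    with True show ?thesis
      by (intro exI[of _ c]) (auto simp: less_Suc_eq)
  next
    case False
    then obtain p where p: "p \<in> S" "M p k \<noteq> 0" by blast
    define T where "T = S - {p}"
    have T: "finite T" "k < card T" "p \<notin> T" "S = insert p T"
      using Suc.prems p by (auto simp: T_def)
    \<comment> \<open>Gaussian elimination with pivot \<open>p\<close>: subtracting multiples of row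
      \<open>p\<close> clears coordinate \<open>k\<close> in the rows of \<open>T\<close>, so
      \<open>k\<close> coordinates remain for more than \<open>k\<close> rows.\<close>
    obtain c where c: "\<exists>i\<in>T. c i \<noteq> 0"
      and rel: "\<forall>j<k. (\<Sum>i\<in>T. c i * (M i j - M i k / M p k * M p j)) = 0"
      using Suc.IH[of T "\<lambda>i j. M i j - M i k / M p k * M p j"] T by auto
    \<comment> \<open>The coefficient at \<open>p\<close> collects all the multiples of row
      \<open>p\<close> that were subtracted, so that the relation holds for the original
      rows.\<close>
    define e where "e i = (if i = p then - (\<Sum>i\<in>T. c i * M i k) / M p k else c i)" for i
    have "(\<Sum>i\<in>S. e i * M i j) = (\<Sum>i\<in>T. c i * (M i j - M i k / M p k * M p j))" for j
    proof -
      have "(\<Sum>i\<in>S. e i * M i j) = e p * M p j + (\<Sum>i\<in>T. c i * M i j)"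
        using T by (auto simp: e_def intro!: sum.cong)
      also have "e p * M p j = - (\<Sum>i\<in>T. c i * (M i k / M p k * M p j))"
        by (simp add: e_def sum_distrib_right sum_divide_distrib mult.assoc)
      finally show ?thesis by (simp add: algebra_simps sum_subtractf)
    qed
    with rel p have "(\<Sum>i\<in>S. e i * M i j) = 0" if "j < Suc k" for j
      using that by (cases "j = k") auto
    moreover have "\<exists>i\<in>S. e i \<noteq> 0"
      using c T by (auto simp: e_def)
    ultimately show ?thesis by blast
  qed
qed

lemma mod_sum_smult:
  fixes p :: "'i \<Rightarrow> 'a::field poly"
  shows "(\<Sum>i\<in>I. smult (c i) (p i)) mod m = (\<Sum>i\<in>I. smult (c i) (p i mod m))"
  by (induction I rule: infinite_finite_induct) (simp_all add: poly_mod_add_left mod_smult_left)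

text \<open>Since \<open>h\<close> is a unit at the point, a polynomial matters modulo the ideal
  only through its restriction to the horizontal line through the point, taken modulo the
  \<open>k\<close>-th power of the linear factor vanishing there. That leaves \<open>k\<close>
  scalars, so more than \<open>k\<close> elements of the local ring are dependent.\<close>

lemma intersection_mult_le:
  assumes h: "eval2 h (x, y) \<noteq> 0"
    and hy: "h * [:[:- y:], 1:] = A * dehom F + B * dehom G"
    and hx: "h * [:[:- x, 1:] ^ k:] = A' * dehom F + B' * dehom G"
  shows "intersection_mult (x, y) F G \<le> enat k"
proof -
  let ?P = "(x, y)"
  have "n \<le> k"
    if r: "\<forall>i<n. r i \<in> local_ring ?P"
      and ind: "\<forall>c. (\<Sum>i<n. Fract [:[:c i:]:] 1 * r i) \<in> local_ideal ?P (dehom F) (dehom G)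
        \<longrightarrow> (\<forall>i<n. c i = 0)" for n r
  proof (rule ccontr)
    assume "\<not> n \<le> k"
    have "\<forall>i. \<exists>p q. i < n \<longrightarrow> eval2 q ?P \<noteq> 0 \<and> r i = Fract p q"
      using r unfolding local_ring_def by blast
    then obtain p q where q: "\<And>i. i < n \<Longrightarrow> eval2 (q i) ?P \<noteq> 0"
      and rpq: "\<And>i. i < n \<Longrightarrow> r i = Fract (p i) (q i)"
      by metis
    \<comment> \<open>A common denominator. It is a unit at the point, so a relation between the
      numerators \<open>p' i\<close> modulo the ideal carries over to the
      \<open>r i\<close>.\<close>
    define Q where "Q = (\<Prod>i<n. q i)"
    define p' where "p' i = p i * (\<Prod>j\<in>{..<n} - {i}. q j)" for i
    have Q: "eval2 Q ?P \<noteq> 0"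
      using q by (simp add: Q_def)
    then have "Q \<noteq> 0" by auto
    have Qi: "Q = q i * (\<Prod>j\<in>{..<n} - {i}. q j)" if "i < n" for i
      using that by (simp add: Q_def prod.remove)
    have rp': "r i = Fract (p' i) 1 * Fract 1 Q" if "i < n" for i
      using \<open>Q \<noteq> 0\<close> q[OF that] rpq[OF that] eval2_nonzero_imp_nonzero[OF q[OF that]]
      by (simp add: eq_fract p'_def Qi[OF that] algebra_simps)
    define w where "w i = poly (p' i) [:y:]" for i
    let ?m = "[:- x, 1:] ^ k"
    \<comment> \<open>The remainder of \<open>w i\<close> modulo \<open>?m\<close> is a vector of
      \<open>k\<close> coefficients, and there are \<open>n > k\<close> of them.\<close>
    obtain c where c: "\<exists>i\<in>{..<n}. c i \<noteq> 0"
      and rel: "\<forall>j<k. (\<Sum>i<n. c i * coeff (w i mod ?m) j) = 0"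
      using exists_nontrivial_linear_relation[of "{..<n}" k "\<lambda>i. coeff (w i mod ?m)"]
        \<open>\<not> n \<le> k\<close> by auto
    define s where "s = (\<Sum>i<n. [:[:c i:]:] * p' i)"
    have "(\<Sum>i<n. smult (c i) (w i mod ?m)) = 0" (is "?v = 0")
    proof (rule poly_eqI)
      fix j
      show "coeff ?v j = coeff 0 j"
      proof (cases "j < k")
        case True
        then show ?thesis using rel by (simp add: coeff_sum)
      next
        case False
        have "coeff (w i mod ?m) j = 0" for i
        proof (cases "w i mod ?m = 0")
          case nz: False
          then have "degree (w i mod ?m) < degree ?m"
            by (intro degree_mod_less') auto
          then show ?thesis
            using False by (intro coeff_eq_0) (simp add: degree_linear_power)
        qed simp
        then show ?thesis by (simp add: coeff_sum)
      qed
    qed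
    moreover have w_s: "poly s [:y:] = (\<Sum>i<n. smult (c i) (w i))"
      by (simp add: s_def w_def poly_sum)
    ultimately have "?m dvd poly s [:y:]"
      by (simp add: mod_eq_0_iff_dvd[symmetric] mod_sum_smult)
    then obtain u where u: "poly s [:y:] = ?m * u" by (elim dvdE)
    \<comment> \<open>Division by the linear polynomial in the outer variable leaves the restriction
      of \<open>s\<close> to the horizontal line, a multiple of \<open>?m\<close>. Both summands
      fall into the ideal after multiplication by \<open>h\<close>, by \<open>hy\<close> and
      \<open>hx\<close>.\<close>
    define v where "v = synthetic_div s [:y:]"
    have "s = [:[:- y:], 1:] * v + [:?m:] * [:u:]"
      using synthetic_div_correct'[of "[:y:]" s] by (simp add: v_def u mult.commute)
    then have "h * s = (h * [:[:- y:], 1:]) * v + (h * [:?m:]) * [:u:]"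
      by (simp only: distrib_left mult.assoc)
    also have "\<dots> = (A * v + A' * [:u:]) * dehom F + (B * v + B' * [:u:]) * dehom G"
      unfolding hx hy by (simp only: algebra_simps)
    finally have "Fract s Q \<in> local_ideal ?P (dehom F) (dehom G)"
      using h by (subst Fract_mem_local_ideal_iff[OF Q]) blast
    also have "Fract s Q = Fract s 1 * Fract 1 Q"
      by simp
    also have "Fract s 1 = (\<Sum>i<n. Fract [:[:c i:]:] 1 * Fract (p' i) 1)"
      by (simp add: s_def Fract_sum del: mult_pCons_left)
    also have "\<dots> * Fract 1 Q = (\<Sum>i<n. Fract [:[:c i:]:] 1 * r i)"
      by (simp add: sum_distrib_right rp' mult.assoc del: mult_fract)
    finally show False
      using ind c by auto
  qed
  then show ?thesis
    unfolding intersection_mult_def by (auto intro!: Sup_least)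
qed

section \<open>Conics meeting the Edwards curve\<close>

lemma conic_form_eq:
  "conic_form \<alpha> \<beta> \<gamma> = [:[:0, [:0, \<beta>:]:], [:[:0, \<gamma>:], [:\<alpha>:]:], [:[:\<alpha>:]:]:]"
  by (simp add: conic_form_def cst_def varX_def varY_def varZ_def power2_eq_square algebra_simps)

lemma dehom_conic_form: "dehom (conic_form \<alpha> \<beta> \<gamma>) = [:[:\<alpha>, \<gamma>:], [:\<alpha>, \<beta>:]:]"
  by (simp add: dehom_def conic_form_eq one_pCons)

lemma dehom_edwards_curve:
  "dehom (edwards_curve a d) = [:[:- 1, 0, a:], 0, [:1, 0, - d:]:]"
  by (simp add: dehom_def edwards_curve_def cst_def varX_def varY_def varZ_def
      power2_eq_square power4_eq_xxxx one_pCons algebra_simps)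

text \<open>The two expressions are half the partial derivatives. If both vanish away from the axes,
  then d x^2 = 1 and a = d y^2, so the equation gives a x^2 = 1 = d x^2, against
  \<open>a \<noteq> d\<close>. On an axis both coordinates would be 0.\<close>

lemma edwards_curve_smooth:
  fixes a d x y :: "'a::field"
  assumes "a \<noteq> 0" "a \<noteq> d" and on: "a * x\<^sup>2 + y\<^sup>2 = 1 + d * x\<^sup>2 * y\<^sup>2"
  shows "y * (1 - d * x\<^sup>2) \<noteq> 0 \<or> x * (a - d * y\<^sup>2) \<noteq> 0"
proof (rule ccontr)
  assume "\<not> ?thesis"
  then have *: "y * (1 - d * x\<^sup>2) = 0" "x * (a - d * y\<^sup>2) = 0" by auto
  show False
  proof (cases "x = 0 \<or> y = 0")
    case True
    with * on \<open>a \<noteq> 0\<close> show False by auto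
  next
    case False
    with * have "d * x\<^sup>2 = 1" "a = d * y\<^sup>2" by auto
    with on have "a * x\<^sup>2 = 1" by simp
    with \<open>d * x\<^sup>2 = 1\<close> have "(a - d) * x\<^sup>2 = 0" by (simp add: left_diff_distrib)
    with False \<open>a \<noteq> d\<close> show False by simp
  qed
qed

section \<open>Multiplicity requirements as linear conditions on the conic\<close>

lemma one_le_intersection_mult:
  fixes a d x y :: "'a::field"
  assumes on: "a * x\<^sup>2 + y\<^sup>2 = 1 + d * x\<^sup>2 * y\<^sup>2"
    and C: "\<alpha> * (1 + y) + \<beta> * (x * y) + \<gamma> * x = 0"
  shows "enat 1 \<le> intersection_mult (x, y) (conic_form \<alpha> \<beta> \<gamma>) (edwards_curve a d)"
proof -
  \<comment> \<open>For order 1 any germ through the point will do; this is the horizontal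
    line.\<close>
  have "[:0, 1:] ^ 1 dvd subst2 [:x, 1:] [:y:] (dehom (conic_form \<alpha> \<beta> \<gamma>))"
    unfolding linear_power_dvd_iff dehom_conic_form
    using C by (simp add: pcompose_pCons algebra_simps)
  moreover have "[:0, 1:] ^ 1 dvd subst2 [:x, 1:] [:y:] (dehom (edwards_curve a d))"
    unfolding linear_power_dvd_iff dehom_edwards_curve
    using on by (simp add: pcompose_pCons algebra_simps power2_eq_square)
  moreover have "subst2 [:x, 1:] [:y:] [:[:- x, 1:]:] = [:0, 1:]"
    by (simp add: pcompose_pCons)
  ultimately show ?thesis
    using le_intersection_mult by fastforce
qed

text \<open>The equation says that half the Jacobian determinant of the two affine equations
  vanishes at the point. If it does not, Cramer's rule puts both coordinate differences into the
  local ideal and the length is at most 1. If it does, the conic is constant to first order along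
  the tangent line of the curve.\<close>

lemma two_le_intersection_mult_iff:
  fixes a d x y :: "'a::field"
  assumes two: "(2::'a) \<noteq> 0" and "a \<noteq> 0" "a \<noteq> d"
    and on: "a * x\<^sup>2 + y\<^sup>2 = 1 + d * x\<^sup>2 * y\<^sup>2"
    and C: "\<alpha> * (1 + y) + \<beta> * (x * y) + \<gamma> * x = 0"
  shows "enat 2 \<le> intersection_mult (x, y) (conic_form \<alpha> \<beta> \<gamma>) (edwards_curve a d) \<longleftrightarrow>
    (\<beta> * y + \<gamma>) * (y * (1 - d * x\<^sup>2)) = (\<alpha> + \<beta> * x) * (x * (a - d * y\<^sup>2))"
    (is "?L \<longleftrightarrow> ?R")
proof
  assume ?L
  show ?R
  proof (rule ccontr)
    assume neq: "\<not> ?R"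
    \<comment> \<open>Both equations vanish at the point, hence are combinations of \<open>X\<close>
      and \<open>Y\<close>. \<open>A\<close>, \<open>B\<close>, \<open>A'\<close>, \<open>B'\<close>
      are their cofactors, whose values at the point are the partial derivatives.\<close>
    define A where "A = [:[:\<gamma>:], [:\<beta>:]:]"
    define B where "B = [:[:\<alpha> + \<beta> * x:]:]"
    define A' where "A' = [:[:a * x, a:], 0, [:- d * x, - d:]:]"
    define B' where "B' = [:[:(1 - d * x\<^sup>2) * y:], [:1 - d * x\<^sup>2:]:]"
    \<comment> \<open>The determinant of the cofactors, which multiplies \<open>X\<close> and
      \<open>Y\<close> into the ideal.\<close>
    define h where "h = A * B' - B * A'"
    define X Y where "X = [:[:- x, 1:]:]" and "Y = [:[:- y:], 1:]"
    have F: "dehom (conic_form \<alpha> \<beta> \<gamma>) = X * A + Y * B"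
      using C by (simp add: X_def Y_def dehom_conic_form A_def B_def algebra_simps one_pCons eq_neg_iff_add_eq_0)
    have G: "dehom (edwards_curve a d) = X * A' + Y * B'"
      using on by (simp add: X_def Y_def dehom_edwards_curve A'_def B'_def algebra_simps one_pCons
          power2_eq_square eq_neg_iff_add_eq_0)
    have "eval2 h (x, y) = 2 * ((\<beta> * y + \<gamma>) * (y * (1 - d * x\<^sup>2)) - (\<alpha> + \<beta> * x) * (x * (a - d * y\<^sup>2)))"
      by (simp add: h_def A_def B_def A'_def B'_def eval2_def algebra_simps power2_eq_square)
    with neq two have "eval2 h (x, y) \<noteq> 0" by simp
    moreover have "h * [:[:- y:], 1:] = (- A') * dehom (conic_form \<alpha> \<beta> \<gamma>) + A * dehom (edwards_curve a d)"
      unfolding F G h_def Y_def[symmetric] by (simp add: algebra_simps)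
    moreover have "h * [:[:- x, 1:] ^ 1:] = B' * dehom (conic_form \<alpha> \<beta> \<gamma>) + (- B) * dehom (edwards_curve a d)"
      unfolding F G h_def power_one_right X_def[symmetric] by (simp add: algebra_simps)
    ultimately have "intersection_mult (x, y) (conic_form \<alpha> \<beta> \<gamma>) (edwards_curve a d) \<le> enat 1"
      by (rule intersection_mult_le)
    with \<open>?L\<close> have "enat 2 \<le> enat 1" by (rule order_trans)
    then show False by simp
  qed
next
  assume ?R
  \<comment> \<open>(\<open>u\<close>, \<open>v\<close>) is half the gradient of the curve turned by
    a right angle, a tangent direction that is nonzero by smoothness.\<close>
  define u where "u = y * (1 - d * x\<^sup>2)"
  define v where "v = - (x * (a - d * y\<^sup>2))"
  have uv: "u \<noteq> 0 \<or> v \<noteq> 0"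
    using edwards_curve_smooth[OF \<open>a \<noteq> 0\<close> \<open>a \<noteq> d\<close> on] by (simp add: u_def v_def)
  \<comment> \<open>A linear form with value 1 on the tangent direction; taken relative to the
    point, it restricts to t on the tangent line.\<close>
  define p q where "p = (if u = 0 then 0 else 1 / u)" and "q = (if u = 0 then 1 / v else 0)"
  have pq: "p * u + q * v = 1"
    using uv by (auto simp: p_def q_def)
  have tan: "(\<beta> * y + \<gamma>) * u + (\<alpha> + \<beta> * x) * v = 0"
    using \<open>?R\<close> by (simp add: u_def v_def)
  have tan': "x * (a - d * y\<^sup>2) * u + y * (1 - d * x\<^sup>2) * v = 0"
    by (simp add: u_def v_def)
  have "[:0, 1:] ^ 2 dvd subst2 [:x, u:] [:y, v:] (dehom (conic_form \<alpha> \<beta> \<gamma>))"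
    unfolding linear_power_dvd_iff dehom_conic_form
    using C tan by (simp add: pcompose_pCons numeral_2_eq_2 less_Suc_eq algebra_simps)
  moreover have "[:0, 1:] ^ 2 dvd subst2 [:x, u:] [:y, v:] (dehom (edwards_curve a d))"
  proof -
    have "2 * (x * (a - d * y\<^sup>2) * u + y * (1 - d * x\<^sup>2) * v) = 0"
      unfolding tan' by simp
    then show ?thesis
      unfolding linear_power_dvd_iff dehom_edwards_curve
      using on by (simp add: pcompose_pCons numeral_2_eq_2 less_Suc_eq algebra_simps)
  qed
  moreover have "subst2 [:x, u:] [:y, v:] [:[:- p * x - q * y, p:], [:q:]:] = [:0, 1:]"
    using pq by (simp add: pcompose_pCons algebra_simps)
  ultimately show ?L
    using le_intersection_mult[of 2 "[:x, u:]" "[:y, v:]" "conic_form \<alpha> \<beta> \<gamma>" "edwards_curve a d"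
      "[:[:- p * x - q * y, p:], [:q:]:]"] by simp
qed

text \<open>Order 2 already forces \<open>\<beta> = \<gamma>\<close>, and the conic then splits as
  (1 + y)(\<alpha> + \<beta> x). If \<open>\<alpha> \<noteq> 0\<close>, the second factor is a unit
  at the point, so 1 + y lies in the ideal. As the curve equation becomes (a - d) x^2 at y = -1, so
  does x^2, and the length is at most 2.\<close>

lemma three_le_intersection_mult_iff:
  fixes a d :: "'a::field"
  assumes two: "(2::'a) \<noteq> 0" and "a \<noteq> 0" "a \<noteq> d"
  shows "enat 3 \<le> intersection_mult (0, - 1) (conic_form \<alpha> \<beta> \<gamma>) (edwards_curve a d) \<longleftrightarrow>
    \<beta> = \<gamma> \<and> \<alpha> = 0"
proof
  assume L: "enat 3 \<le> intersection_mult (0, - 1) (conic_form \<alpha> \<beta> \<gamma>) (edwards_curve a d)"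
  moreover have "enat 2 \<le> enat 3" by simp
  ultimately have "enat 2 \<le> intersection_mult (0, - 1) (conic_form \<alpha> \<beta> \<gamma>) (edwards_curve a d)"
    by (rule order_trans[rotated])
  then have "\<beta> = \<gamma>"
    using two_le_intersection_mult_iff[OF two \<open>a \<noteq> 0\<close> \<open>a \<noteq> d\<close>, of 0 "- 1"] by simp
  moreover have "\<alpha> = 0"
  proof (rule ccontr)
    assume "\<alpha> \<noteq> 0"
    define h where "h = [:[:\<alpha> * (a - d), \<beta> * (a - d):]:]"
    have "eval2 h (0, - 1) \<noteq> 0"
      using \<open>\<alpha> \<noteq> 0\<close> \<open>a \<noteq> d\<close> by (simp add: h_def eval2_def)
    moreover have "h * [:[:- (- 1):], 1:] = [:[:a - d:]:] * dehom (conic_form \<alpha> \<beta> \<gamma>)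
        + 0 * dehom (edwards_curve a d)"
      using \<open>\<beta> = \<gamma>\<close> by (simp add: h_def dehom_conic_form algebra_simps)
    \<comment> \<open>The cofactors come from writing the curve polynomial as (a - d) x^2 + (y +
      1)(y - 1)(1 - d x^2).\<close>
    moreover have "h * [:[:- 0, 1:] ^ 2:] =
        [:[:1, 0, - d:], [:- 1, 0, d:]:] * dehom (conic_form \<alpha> \<beta> \<gamma>)
        + [:[:\<alpha>, \<beta>:]:] * dehom (edwards_curve a d)"
      using \<open>\<beta> = \<gamma>\<close>
      by (simp add: h_def dehom_conic_form dehom_edwards_curve power2_eq_square algebra_simps)
    ultimately have "intersection_mult (0, - 1) (conic_form \<alpha> \<beta> \<gamma>) (edwards_curve a d) \<le> enat 2"
      by (rule intersection_mult_le)
    with L have "enat 3 \<le> enat 2" by (rule order_trans)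
    then show False by simp
  qed
  ultimately show "\<beta> = \<gamma> \<and> \<alpha> = 0" by simp
next
  assume R: "\<beta> = \<gamma> \<and> \<alpha> = 0"
  \<comment> \<open>This curvature cancels the t^2 coefficient of the curve equation along (t, -1 +
    k t^2). There the conic \<beta> x (1 + y) becomes \<beta> k t^3.\<close>
  define k where "k = (a - d) / 2"
  have "k * 2 = a - d"
    using nonzero_eq_divide_eq[OF two, of k "a - d"] k_def by blast
  then have k: "d + k * 2 = a" by simp
  have "[:0, 1:] ^ 3 dvd subst2 [:0, 1:] [:- 1, 0, k:] (dehom (conic_form \<alpha> \<beta> \<gamma>))"
    unfolding linear_power_dvd_iff dehom_conic_form
    using R by (simp add: pcompose_pCons numeral_3_eq_3 less_Suc_eq algebra_simps)
  moreover have "[:0, 1:] ^ 3 dvd subst2 [:0, 1:] [:- 1, 0, k:] (dehom (edwards_curve a d))"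
    unfolding linear_power_dvd_iff dehom_edwards_curve
    using k by (simp add: pcompose_pCons numeral_3_eq_3 less_Suc_eq algebra_simps)
  moreover have "subst2 [:0, 1:] [:- 1, 0, k:] [:[:0, 1:]:] = [:0, 1:]"
    by (simp add: pcompose_pCons)
  ultimately show "enat 3 \<le> intersection_mult (0, - 1) (conic_form \<alpha> \<beta> \<gamma>) (edwards_curve a d)"
    using le_intersection_mult[of 3 "[:0, 1:]" "[:- 1, 0, k:]" "conic_form \<alpha> \<beta> \<gamma>"
        "edwards_curve a d" "[:[:0, 1:]:]"] by simp
qed

section \<open>Projective points and the linear system of conics\<close>

lemma mem_proj_point: "v \<in> proj_point X Y Z \<longleftrightarrow> (\<exists>t. t \<noteq> 0 \<and> v = (t * X, t * Y, t * Z))"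
  by (auto simp: proj_point_def)

lemma proj_point_scale:
  assumes "s \<noteq> 0"
  shows "proj_point (s * X) (s * Y) (s * Z) = proj_point X Y Z"
proof (rule set_eqI)
  fix v
  show "v \<in> proj_point (s * X) (s * Y) (s * Z) \<longleftrightarrow> v \<in> proj_point X Y Z"
  proof
    assume "v \<in> proj_point (s * X) (s * Y) (s * Z)"
    then obtain t where "t \<noteq> 0" "v = (t * (s * X), t * (s * Y), t * (s * Z))"
      by (auto simp: mem_proj_point)
    with assms show "v \<in> proj_point X Y Z"
      by (auto simp: mem_proj_point mult.assoc intro!: exI[of _ "t * s"])
  next
    assume "v \<in> proj_point X Y Z"
    then obtain t where "t \<noteq> 0" "v = (t * X, t * Y, t * Z)"
      by (auto simp: mem_proj_point)
    with assms show "v \<in> proj_point (s * X) (s * Y) (s * Z)"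
      by (auto simp: mem_proj_point intro!: exI[of _ "t / s"])
  qed
qed

lemma proj_point_affine_eq_iff: "proj_point x y 1 = proj_point x' y' 1 \<longleftrightarrow> x = x' \<and> y = y'"
proof
  assume "proj_point x y 1 = proj_point x' y' 1"
  moreover have "(x, y, 1) \<in> proj_point x y 1"
    by (auto simp: mem_proj_point intro!: exI[of _ 1])
  ultimately have "(x, y, 1) \<in> proj_point x' y' 1" by simp
  then show "x = x' \<and> y = y'" by (auto simp: mem_proj_point)
qed simp

lemma eval3_conic_form:
  "eval3 (conic_form \<alpha> \<beta> \<gamma>) (x, y, z) = \<alpha> * (z\<^sup>2 + y * z) + \<beta> * x * y + \<gamma> * x * z"
  by (simp add: eval3_def eval2_def conic_form_eq algebra_simps power2_eq_square)

lemma eval3_edwards_curve: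
  "eval3 (edwards_curve a d) (x, y, z) = a * x\<^sup>2 * z\<^sup>2 + y\<^sup>2 * z\<^sup>2 - z ^ 4 - d * x\<^sup>2 * y\<^sup>2"
  by (simp add: eval3_def eval2_def edwards_curve_def cst_def varX_def varY_def varZ_def)

lemma on_curve_affine_conic_form:
  "on_curve (proj_point x y 1) (conic_form \<alpha> \<beta> \<gamma>) \<longleftrightarrow> \<alpha> * (1 + y) + \<beta> * (x * y) + \<gamma> * x = 0"
proof -
  have "eval3 (conic_form \<alpha> \<beta> \<gamma>) (t * x, t * y, t) =
      t\<^sup>2 * (\<alpha> * (1 + y) + \<beta> * (x * y) + \<gamma> * x)" for t
    by (simp add: eval3_conic_form algebra_simps power2_eq_square)
  from this[of 1] this show ?thesis
    by (fastforce simp: on_curve_def mem_proj_point)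
qed

lemma on_curve_affine_edwards_curve:
  assumes "on_curve (proj_point x y 1) (edwards_curve a d)"
  shows "a * x\<^sup>2 + y\<^sup>2 = 1 + d * x\<^sup>2 * y\<^sup>2"
proof -
  have "(x, y, 1) \<in> proj_point x y 1"
    by (auto simp: mem_proj_point intro!: exI[of _ 1])
  with assms have "eval3 (edwards_curve a d) (x, y, 1) = 0"
    by (auto simp: on_curve_def)
  then show ?thesis by (simp add: eval3_edwards_curve algebra_simps)
qed

section \<open>The linear system of conics and its solution by a cross product\<close>

lemma is_conic_conic_form_iff:
  "is_conic (conic_form \<alpha> \<beta> \<gamma>) \<longleftrightarrow> (\<alpha>, \<beta>, \<gamma>) \<noteq> (0, 0, 0)"
  by (auto simp: is_conic_def homogeneous_def conic_form_eq coeff_pCons split: nat.splits)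

lemma homogeneous_2_eq:
  assumes "homogeneous 2 \<phi>"
  shows "\<phi> = [:[:[:0, 0, coeff (coeff (coeff \<phi> 0) 0) 2:], [:0, coeff (coeff (coeff \<phi> 0) 1) 1:],
      [:coeff (coeff (coeff \<phi> 0) 2) 0:]:],
    [:[:0, coeff (coeff (coeff \<phi> 1) 0) 1:], [:coeff (coeff (coeff \<phi> 1) 1) 0:]:],
    [:[:coeff (coeff (coeff \<phi> 2) 0) 0:]:]:]" (is "_ = ?r")
proof (intro poly_eqI)
  fix k j i
  have "i + j + k = 2 \<Longrightarrow> coeff (coeff (coeff \<phi> k) j) i = coeff (coeff (coeff ?r k) j) i"
    by (auto simp: coeff_pCons numeral_2_eq_2 split: nat.splits)
  moreover have "i + j + k \<noteq> 2 \<Longrightarrow> coeff (coeff (coeff \<phi> k) j) i = 0"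
    using assms by (auto simp: homogeneous_def)
  moreover have "i + j + k \<noteq> 2 \<Longrightarrow> coeff (coeff (coeff ?r k) j) i = 0"
    by (auto simp: coeff_pCons numeral_2_eq_2 split: nat.splits)
  ultimately show "coeff (coeff (coeff \<phi> k) j) i = coeff (coeff (coeff ?r k) j) i"
    by metis
qed

text \<open>The points at infinity kill the coefficients of X^2 and Y^2; then O' equates those of YZ
  and Z^2.\<close>

lemma conic_through_infinity_and_Oprime:
  assumes "homogeneous 2 \<phi>" "on_curve Omega1 \<phi>" "on_curve Omega2 \<phi>" "on_curve Oprime \<phi>"
  shows "\<exists>\<alpha> \<beta> \<gamma>. \<phi> = conic_form \<alpha> \<beta> \<gamma>"
proof -
  obtain c200 c110 c020 c101 c011 c002 where \<phi>:
    "\<phi> = [:[:[:0, 0, c200:], [:0, c110:], [:c020:]:], [:[:0, c101:], [:c011:]:], [:[:c002:]:]:]"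
    using homogeneous_2_eq[OF assms(1)] by blast
  have "(1, 0, 0) \<in> Omega1" "(0, 1, 0) \<in> Omega2" "(0, - 1, 1) \<in> Oprime"
    by (auto simp: Omega1_def Omega2_def Oprime_def mem_proj_point intro!: exI[of _ 1])
  with assms have "eval3 \<phi> (1, 0, 0) = 0" "eval3 \<phi> (0, 1, 0) = 0" "eval3 \<phi> (0, - 1, 1) = 0"
    by (auto simp: on_curve_def)
  then have "c200 = 0" "c020 = 0" "c011 = c002"
    by (auto simp: \<phi> eval3_def eval2_def)
  then have "\<phi> = conic_form c002 c110 c101"
    by (simp add: \<phi> conic_form_eq)
  then show ?thesis by blast
qed

lemma conic_form_through:
  "on_curve Omega1 (conic_form \<alpha> \<beta> \<gamma>)" "on_curve Omega2 (conic_form \<alpha> \<beta> \<gamma>)"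
  "on_curve Oprime (conic_form \<alpha> \<beta> \<gamma>)"
  by (auto simp: on_curve_def Omega1_def Omega2_def Oprime_def mem_proj_point eval3_conic_form
      power2_eq_square)

text \<open>Two independent linear conditions \<open>m\<close>, \<open>n\<close> on a vector leave
  the line spanned by their cross product. The factor \<open>k\<close> allows for formulas from
  which a common factor has been cancelled.\<close>

lemma cross_product_solution:
  fixes m1 :: "'a::field"
  assumes "k \<noteq> 0" and "(c1, c2, c3) \<noteq> (0, 0, 0)"
    and "k * c1 = m2 * n3 - m3 * n2" "k * c2 = m3 * n1 - m1 * n3" "k * c3 = m1 * n2 - m2 * n1"
  shows "(v1 * m1 + v2 * m2 + v3 * m3 = 0 \<and> v1 * n1 + v2 * n2 + v3 * n3 = 0) \<longleftrightarrow>
    (\<exists>t. v1 = t * c1 \<and> v2 = t * c2 \<and> v3 = t * c3)" (is "?L \<longleftrightarrow> ?R")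
proof
  assume ?L
  \<comment> \<open>These are the coordinates of v x (m x n) = m (v.n) - n (v.m). Under the two
    conditions the vectors \<open>v\<close> and \<open>c\<close> are therefore parallel.\<close>
  have "k * (v1 * c2 - v2 * c1) =
      m3 * (v1 * n1 + v2 * n2 + v3 * n3) - n3 * (v1 * m1 + v2 * m2 + v3 * m3)"
    using assms(3-5) by algebra
  moreover have "k * (v2 * c3 - v3 * c2) =
      m1 * (v1 * n1 + v2 * n2 + v3 * n3) - n1 * (v1 * m1 + v2 * m2 + v3 * m3)"
    using assms(3-5) by algebra
  moreover have "k * (v3 * c1 - v1 * c3) =
      m2 * (v1 * n1 + v2 * n2 + v3 * n3) - n2 * (v1 * m1 + v2 * m2 + v3 * m3)"
    using assms(3-5) by algebra
  ultimately have *: "v1 * c2 = v2 * c1" "v2 * c3 = v3 * c2" "v3 * c1 = v1 * c3"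
    using \<open>?L\<close> \<open>k \<noteq> 0\<close> by auto
  consider "c1 \<noteq> 0" | "c2 \<noteq> 0" | "c3 \<noteq> 0" using assms(2) by auto
  then show ?R
  proof cases
    case 1
    with * show ?thesis by (intro exI[of _ "v1 / c1"]) (auto simp: field_simps)
  next
    case 2
    with * show ?thesis by (intro exI[of _ "v2 / c2"]) (auto simp: field_simps)
  next
    case 3
    with * show ?thesis by (intro exI[of _ "v3 / c3"]) (auto simp: field_simps)
  qed
next
  assume ?R
  then obtain t where t: "v1 = t * c1" "v2 = t * c2" "v3 = t * c3" by blast
  have "k * (v1 * m1 + v2 * m2 + v3 * m3) = 0" "k * (v1 * n1 + v2 * n2 + v3 * n3) = 0"
    unfolding t using assms(3-5) by algebra+
  with \<open>k \<noteq> 0\<close> show ?L by simp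
qed

text \<open>Reduces each configuration of points to finding two linear conditions equivalent to the
  requirements. Nonzero multiples of \<open>c\<close> correspond to genuine conics because the zero
  form is not a conic.\<close>

lemma conic_determinedI:
  assumes "k \<noteq> 0" and "(c1, c2, c3) \<noteq> (0, 0, 0)"
    and "k * c1 = m2 * n3 - m3 * n2" "k * c2 = m3 * n1 - m1 * n3" "k * c3 = m1 * n2 - m2 * n1"
    and pass: "\<And>\<alpha> \<beta> \<gamma>. passes_through_required a d P1 P2 (conic_form \<alpha> \<beta> \<gamma>) \<longleftrightarrow>
      \<alpha> * m1 + \<beta> * m2 + \<gamma> * m3 = 0 \<and> \<alpha> * n1 + \<beta> * n2 + \<gamma> * n3 = 0"
  shows "conic_determined a d P1 P2 c1 c2 c3"
  unfolding conic_determined_def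
proof (intro conjI allI)
  fix \<phi>
  show "is_conic \<phi> \<and> passes_through_required a d P1 P2 \<phi> \<longleftrightarrow>
    (\<exists>t. t \<noteq> 0 \<and> \<phi> = conic_form (t * c1) (t * c2) (t * c3))" (is "?L \<longleftrightarrow> ?R")
  proof
    assume ?L
    then obtain \<alpha> \<beta> \<gamma> where \<phi>: "\<phi> = conic_form \<alpha> \<beta> \<gamma>"
      using conic_through_infinity_and_Oprime
      unfolding is_conic_def passes_through_required_def by blast
    with \<open>?L\<close> obtain t where "\<alpha> = t * c1" "\<beta> = t * c2" "\<gamma> = t * c3"
      using cross_product_solution[OF assms(1-5)] pass by blast
    moreover from this have "t \<noteq> 0"
      using \<open>?L\<close> by (auto simp: \<phi> is_conic_conic_form_iff)
    ultimately show ?R using \<phi> by blast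
  next
    assume ?R
    then obtain t where "t \<noteq> 0" and \<phi>: "\<phi> = conic_form (t * c1) (t * c2) (t * c3)" by blast
    moreover have "passes_through_required a d P1 P2 \<phi>"
      unfolding \<phi> pass using cross_product_solution[OF assms(1-5)] by blast
    ultimately show ?L
      using assms(2) by (auto simp: is_conic_conic_form_iff)
  qed
qed fact

lemma conic_determined_scale:
  assumes "conic_determined a d P1 P2 c1 c2 c3" "s \<noteq> 0"
  shows "conic_determined a d P1 P2 (s * c1) (s * c2) (s * c3)"
proof -
  have "(\<exists>t. t \<noteq> 0 \<and> \<phi> = conic_form (t * (s * c1)) (t * (s * c2)) (t * (s * c3))) \<longleftrightarrow>
    (\<exists>t. t \<noteq> 0 \<and> \<phi> = conic_form (t * c1) (t * c2) (t * c3))" (is "?L \<longleftrightarrow> ?R") for \<phi>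
  proof
    assume ?L
    then obtain t where "t \<noteq> 0" "\<phi> = conic_form (t * (s * c1)) (t * (s * c2)) (t * (s * c3))" by blast
    with assms(2) show ?R by (intro exI[of _ "t * s"]) (simp add: mult.assoc)
  next
    assume ?R
    then obtain t where "t \<noteq> 0" "\<phi> = conic_form (t * c1) (t * c2) (t * c3)" by blast
    with assms(2) show ?L by (intro exI[of _ "t / s"]) simp
  qed
  with assms show ?thesis by (auto simp: conic_determined_def)
qed

lemma conic_determined_commute:
  "conic_determined a d P1 P2 c1 c2 c3 \<longleftrightarrow> conic_determined a d P2 P1 c1 c2 c3"
proof -
  have "count_list [Oprime, P1, P2] P = count_list [Oprime, P2, P1] P" for P :: "('a \<times> 'a \<times> 'a) set"
    by simp
  then have "passes_through_required a d P1 P2 \<phi> \<longleftrightarrow> passes_through_required a d P2 P1 \<phi>" for \<phi>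
    unfolding passes_through_required_def by metis
  then show ?thesis by (simp add: conic_determined_def)
qed

section \<open>The conic through two points of the Edwards curve\<close>

lemma Oprime_eq_iff: "proj_point x y 1 = Oprime \<longleftrightarrow> x = 0 \<and> y = - 1"
  by (simp add: Oprime_def proj_point_affine_eq_iff)

text \<open>At y = -1 the equation collapses to (a - d) x^2 = 0. So 1 + y is nonzero at every affine
  point of the curve other than O', which makes it available as a cancelled factor.\<close>

lemma edwards_curve_y_minus_1:
  fixes a d x y :: "'a::field"
  assumes "a \<noteq> d" "a * x\<^sup>2 + y\<^sup>2 = 1 + d * x\<^sup>2 * y\<^sup>2" "y = - 1"
  shows "x = 0"
proof -
  have "(a - d) * x\<^sup>2 = 0"
    using assms by (simp add: algebra_simps)
  with assms show ?thesis by simp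
qed

lemma passes_through_required_conic_form:
  "passes_through_required a d P1 P2 (conic_form \<alpha> \<beta> \<gamma>) \<longleftrightarrow>
    on_curve P1 (conic_form \<alpha> \<beta> \<gamma>) \<and> on_curve P2 (conic_form \<alpha> \<beta> \<gamma>) \<and>
    (\<forall>x y. enat (count_list [Oprime, P1, P2] (proj_point x y 1))
      \<le> intersection_mult (x, y) (conic_form \<alpha> \<beta> \<gamma>) (edwards_curve a d))"
  by (simp add: passes_through_required_def conic_form_through)

context
  fixes a d :: "'a::field"
  assumes two: "(2::'a) \<noteq> 0" and "a \<noteq> 0" "a \<noteq> d"
begin

lemma conic_determined_distinct:
  fixes x1 y1 x2 y2 :: 'a
  assumes on1: "a * x1\<^sup>2 + y1\<^sup>2 = 1 + d * x1\<^sup>2 * y1\<^sup>2"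
    and on2: "a * x2\<^sup>2 + y2\<^sup>2 = 1 + d * x2\<^sup>2 * y2\<^sup>2"
    and neq: "(x1, y1) \<noteq> (x2, y2)" "(x1, y1) \<noteq> (0, - 1)" "(x2, y2) \<noteq> (0, - 1)"
  shows "conic_determined a d (proj_point x1 y1 1) (proj_point x2 y2 1)
    (x1 * x2 * (y1 - y2)) (x1 - x2 + x1 * y2 - x2 * y1) (x2 * y2 - x1 * y1 + y1 * y2 * (x2 - x1))"
proof (rule conic_determinedI[where k = 1 and ?m1.0 = "1 + y1" and ?m2.0 = "x1 * y1" and ?m3.0 = x1
      and ?n1.0 = "1 + y2" and ?n2.0 = "x2 * y2" and ?n3.0 = x2])
  have y: "x1 = 0 \<or> y1 \<noteq> - 1" "x2 = 0 \<or> y2 \<noteq> - 1"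
    using edwards_curve_y_minus_1 \<open>a \<noteq> d\<close> on1 on2 by auto
  show "(x1 * x2 * (y1 - y2), x1 - x2 + x1 * y2 - x2 * y1, x2 * y2 - x1 * y1 + y1 * y2 * (x2 - x1)) \<noteq> (0, 0, 0)"
  proof
    assume "(x1 * x2 * (y1 - y2), x1 - x2 + x1 * y2 - x2 * y1,
      x2 * y2 - x1 * y1 + y1 * y2 * (x2 - x1)) = (0, 0, 0)"
    \<comment> \<open>Since 1 + y1 and 1 + y2 are nonzero, x1 and x2 vanish together. If they do,
      both points are (0, 1); otherwise y1 = y2 and then x1 = x2. Either way the points
      coincide.\<close>
    then have *: "x1 = 0 \<or> x2 = 0 \<or> y1 = y2" "x1 * (1 + y2) = x2 * (1 + y1)"
      by (auto simp: algebra_simps)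
    have y': "1 + y1 \<noteq> 0" "1 + y2 \<noteq> 0"
      using y neq by (auto simp: add_eq_0_iff)
    show False
    proof (cases "x1 = 0 \<or> x2 = 0")
      case True
      with *(2) y' have "x1 = 0" "x2 = 0" by auto
      with on1 on2 have "y1 = 1 \<or> y1 = - 1" "y2 = 1 \<or> y2 = - 1"
        by (auto simp: power2_eq_1_iff)
      with neq \<open>x1 = 0\<close> \<open>x2 = 0\<close> show False by auto
    next
      case False
      with * y' neq show False by auto
    qed
  qed
next
  fix \<alpha> \<beta> \<gamma> :: 'a
  have "(\<forall>x y. enat (count_list [Oprime, proj_point x1 y1 1, proj_point x2 y2 1] (proj_point x y 1))
      \<le> intersection_mult (x, y) (conic_form \<alpha> \<beta> \<gamma>) (edwards_curve a d))"
    if C: "\<alpha> * (1 + y1) + \<beta> * (x1 * y1) + \<gamma> * x1 = 0" "\<alpha> * (1 + y2) + \<beta> * (x2 * y2) + \<gamma> * x2 = 0"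
  proof (intro allI)
    fix x y
    \<comment> \<open>The three points are distinct, so all counts are at most 1 and incidence
      suffices, at O' as well.\<close>
    have "a * 0\<^sup>2 + (- 1)\<^sup>2 = 1 + d * 0\<^sup>2 * (- 1)\<^sup>2" "\<alpha> * (1 + - 1) + \<beta> * (0 * - 1) + \<gamma> * 0 = 0"
      by simp_all
    note one = one_le_intersection_mult[OF on1 C(1)] one_le_intersection_mult[OF on2 C(2)]
      one_le_intersection_mult[OF this]
    show "enat (count_list [Oprime, proj_point x1 y1 1, proj_point x2 y2 1] (proj_point x y 1))
      \<le> intersection_mult (x, y) (conic_form \<alpha> \<beta> \<gamma>) (edwards_curve a d)"
      using neq one by (auto simp: Oprime_def proj_point_affine_eq_iff zero_enat_def[symmetric])
  qed
  then show "passes_through_required a d (proj_point x1 y1 1) (proj_point x2 y2 1) (conic_form \<alpha> \<beta> \<gamma>) \<longleftrightarrow>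
      \<alpha> * (1 + y1) + \<beta> * (x1 * y1) + \<gamma> * x1 = 0 \<and> \<alpha> * (1 + y2) + \<beta> * (x2 * y2) + \<gamma> * x2 = 0"
    unfolding passes_through_required_conic_form on_curve_affine_conic_form by blast
qed (simp_all add: algebra_simps)

text \<open>The conditions are incidence with the first point and tangency at O', which reads
  \<open>\<beta> = \<gamma>\<close>. Their cross product is 1 + y1 times the stated vector.\<close>

lemma conic_determined_Oprime:
  fixes x1 y1 :: 'a
  assumes on1: "a * x1\<^sup>2 + y1\<^sup>2 = 1 + d * x1\<^sup>2 * y1\<^sup>2"
    and neq: "(x1, y1) \<noteq> (0, - 1)"
  shows "conic_determined a d (proj_point x1 y1 1) Oprime (- x1) 1 1"
proof (rule conic_determinedI[where k = "1 + y1" and ?m1.0 = "1 + y1" and ?m2.0 = "x1 * y1" and ?m3.0 = x1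
      and ?n1.0 = 0 and ?n2.0 = 1 and ?n3.0 = "- 1"])
  have "x1 = 0 \<or> y1 \<noteq> - 1"
    using edwards_curve_y_minus_1 \<open>a \<noteq> d\<close> on1 by auto
  with neq show "1 + y1 \<noteq> 0" by (auto simp: add_eq_0_iff)
next
  fix \<alpha> \<beta> \<gamma> :: 'a
  have "a * 0\<^sup>2 + (- 1)\<^sup>2 = 1 + d * 0\<^sup>2 * (- 1)\<^sup>2" "\<alpha> * (1 + - 1) + \<beta> * (0 * - 1) + \<gamma> * 0 = 0"
    by simp_all
  from two_le_intersection_mult_iff[OF two \<open>a \<noteq> 0\<close> \<open>a \<noteq> d\<close> this]
  have iff2: "enat 2 \<le> intersection_mult (0, - 1) (conic_form \<alpha> \<beta> \<gamma>) (edwards_curve a d) \<longleftrightarrow> \<beta> = \<gamma>"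
    by auto
  have "(\<forall>x y. enat (count_list [Oprime, proj_point x1 y1 1, Oprime] (proj_point x y 1))
      \<le> intersection_mult (x, y) (conic_form \<alpha> \<beta> \<gamma>) (edwards_curve a d)) \<longleftrightarrow> \<beta> = \<gamma>" (is "(\<forall>x y. ?Q x y) \<longleftrightarrow> _")
    if C: "\<alpha> * (1 + y1) + \<beta> * (x1 * y1) + \<gamma> * x1 = 0"
  proof
    assume "\<forall>x y. ?Q x y"
    then have "?Q 0 (- 1)" by blast
    then show "\<beta> = \<gamma>"
      using neq iff2 by (auto simp: Oprime_def proj_point_affine_eq_iff numeral_2_eq_2)
  next
    assume "\<beta> = \<gamma>"
    then have "enat (Suc (Suc 0)) \<le> intersection_mult (0, - 1) (conic_form \<alpha> \<beta> \<gamma>) (edwards_curve a d)"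
      using iff2 by (simp add: numeral_2_eq_2)
    then show "\<forall>x y. ?Q x y"
      using neq one_le_intersection_mult[OF on1 C]
      by (auto simp: Oprime_def proj_point_affine_eq_iff zero_enat_def[symmetric])
  qed
  moreover have "on_curve Oprime (conic_form \<alpha> \<beta> \<gamma>)"
    by (rule conic_form_through)
  moreover have \<beta>\<gamma>: "\<alpha> * 0 + \<beta> * 1 + \<gamma> * - 1 = 0 \<longleftrightarrow> \<beta> = \<gamma>"
    by simp
  ultimately show "passes_through_required a d (proj_point x1 y1 1) Oprime (conic_form \<alpha> \<beta> \<gamma>) \<longleftrightarrow>
      \<alpha> * (1 + y1) + \<beta> * (x1 * y1) + \<gamma> * x1 = 0 \<and> \<alpha> * 0 + \<beta> * 1 + \<gamma> * - 1 = 0"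
    unfolding passes_through_required_conic_form on_curve_affine_conic_form \<beta>\<gamma> by blast
qed (simp_all add: algebra_simps)

text \<open>The conditions are incidence and tangency at the point. Modulo the curve equation their
  cross product is divisible by 1 + y, and the quotient is the stated vector.\<close>

lemma conic_determined_tangent:
  fixes x y :: 'a
  assumes on: "a * x\<^sup>2 + y\<^sup>2 = 1 + d * x\<^sup>2 * y\<^sup>2"
    and neq: "(x, y) \<noteq> (0, - 1)"
  shows "conic_determined a d (proj_point x y 1) (proj_point x y 1)
    (x * (1 - y)) (d * x\<^sup>2 * y - 1) (y - a * x\<^sup>2)"
proof (rule conic_determinedI[where k = "1 + y" and ?m1.0 = "1 + y" and ?m2.0 = "x * y" and ?m3.0 = x
      and ?n1.0 = "- (x * (a - d * y\<^sup>2))" and ?n2.0 = "y\<^sup>2 - a * x\<^sup>2" and ?n3.0 = "y * (1 - d * x\<^sup>2)"])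
  have "x = 0 \<or> y \<noteq> - 1"
    using edwards_curve_y_minus_1 \<open>a \<noteq> d\<close> on by auto
  with neq show "1 + y \<noteq> 0" by (auto simp: add_eq_0_iff)
  show "(x * (1 - y), d * x\<^sup>2 * y - 1, y - a * x\<^sup>2) \<noteq> (0, 0, 0)"
  proof
    assume "(x * (1 - y), d * x\<^sup>2 * y - 1, y - a * x\<^sup>2) = (0, 0, 0)"
    \<comment> \<open>The second equation excludes x = 0, so y = 1 and d x^2 = 1 = a x^2, against
      \<open>a \<noteq> d\<close>.\<close>
    then have "x = 0 \<or> y = 1" "d * x\<^sup>2 * y = 1" "y = a * x\<^sup>2" by auto
    then have "d * x\<^sup>2 = 1" "a * x\<^sup>2 = 1" "x \<noteq> 0" by auto
    then have "(a - d) * x\<^sup>2 = 0" by (simp only: left_diff_distrib) simp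
    with \<open>x \<noteq> 0\<close> \<open>a \<noteq> d\<close> show False by simp
  qed
next
  fix \<alpha> \<beta> \<gamma> :: 'a
  have tangent: "(\<beta> * y + \<gamma>) * (y * (1 - d * x\<^sup>2)) = (\<alpha> + \<beta> * x) * (x * (a - d * y\<^sup>2)) \<longleftrightarrow>
    \<alpha> * - (x * (a - d * y\<^sup>2)) + \<beta> * (y\<^sup>2 - a * x\<^sup>2) + \<gamma> * (y * (1 - d * x\<^sup>2)) = 0"
    by (auto simp: algebra_simps power2_eq_square)
  have "(\<forall>x' y'. enat (count_list [Oprime, proj_point x y 1, proj_point x y 1] (proj_point x' y' 1))
      \<le> intersection_mult (x', y') (conic_form \<alpha> \<beta> \<gamma>) (edwards_curve a d)) \<longleftrightarrow>
      enat 2 \<le> intersection_mult (x, y) (conic_form \<alpha> \<beta> \<gamma>) (edwards_curve a d)"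
    (is "(\<forall>x' y'. ?Q x' y') \<longleftrightarrow> ?R")
  proof
    assume "\<forall>x' y'. ?Q x' y'"
    then have "?Q x y" by blast
    then show ?R
      using neq by (auto simp: Oprime_def proj_point_affine_eq_iff numeral_2_eq_2)
  next
    assume ?R
    have "a * 0\<^sup>2 + (- 1)\<^sup>2 = 1 + d * 0\<^sup>2 * (- 1)\<^sup>2" "\<alpha> * (1 + - 1) + \<beta> * (0 * - 1) + \<gamma> * 0 = 0"
      by simp_all
    from one_le_intersection_mult[OF this] \<open>?R\<close> neq show "\<forall>x' y'. ?Q x' y'"
      by (auto simp: Oprime_def proj_point_affine_eq_iff zero_enat_def[symmetric] numeral_2_eq_2)
  qed
  then show "passes_through_required a d (proj_point x y 1) (proj_point x y 1) (conic_form \<alpha> \<beta> \<gamma>) \<longleftrightarrow>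
      \<alpha> * (1 + y) + \<beta> * (x * y) + \<gamma> * x = 0 \<and>
      \<alpha> * - (x * (a - d * y\<^sup>2)) + \<beta> * (y\<^sup>2 - a * x\<^sup>2) + \<gamma> * (y * (1 - d * x\<^sup>2)) = 0"
    unfolding passes_through_required_conic_form on_curve_affine_conic_form
    using two_le_intersection_mult_iff[OF two \<open>a \<noteq> 0\<close> \<open>a \<noteq> d\<close> on] tangent by blast
  show "(1 + y) * (x * (1 - y)) = x * y * (y * (1 - d * x\<^sup>2)) - x * (y\<^sup>2 - a * x\<^sup>2)"
    "(1 + y) * (d * x\<^sup>2 * y - 1) = x * - (x * (a - d * y\<^sup>2)) - (1 + y) * (y * (1 - d * x\<^sup>2))"
    "(1 + y) * (y - a * x\<^sup>2) = (1 + y) * (y\<^sup>2 - a * x\<^sup>2) - x * y * - (x * (a - d * y\<^sup>2))"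
    using on by algebra+
qed

text \<open>Here 1 + y = 0, so the tangent case cannot be specialized; the order 3 condition
  replaces it. The signs are those that the doubling formula yields at (0, -1).\<close>

lemma conic_determined_Oprime_Oprime: "conic_determined a d Oprime Oprime 0 (- 1) (- 1)"
proof (rule conic_determinedI[where k = "- 1" and ?m1.0 = 1 and ?m2.0 = 0 and ?m3.0 = 0
      and ?n1.0 = 0 and ?n2.0 = 1 and ?n3.0 = "- 1"])
  fix \<alpha> \<beta> \<gamma> :: 'a
  have "(\<forall>x y. enat (count_list [Oprime, Oprime, Oprime] (proj_point x y 1))
      \<le> intersection_mult (x, y) (conic_form \<alpha> \<beta> \<gamma>) (edwards_curve a d)) \<longleftrightarrow>
      enat 3 \<le> intersection_mult (0, - 1) (conic_form \<alpha> \<beta> \<gamma>) (edwards_curve a d)"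
    (is "(\<forall>x y. ?Q x y) \<longleftrightarrow> ?R")
  proof
    assume "\<forall>x y. ?Q x y"
    then have "?Q 0 (- 1)" by blast
    then show ?R
      by (auto simp: Oprime_def proj_point_affine_eq_iff numeral_3_eq_3)
  next
    assume ?R
    then show "\<forall>x y. ?Q x y"
      by (auto simp: Oprime_def proj_point_affine_eq_iff zero_enat_def[symmetric] numeral_3_eq_3)
  qed
  then show "passes_through_required a d Oprime Oprime (conic_form \<alpha> \<beta> \<gamma>) \<longleftrightarrow>
      \<alpha> * 1 + \<beta> * 0 + \<gamma> * 0 = 0 \<and> \<alpha> * 0 + \<beta> * 1 + \<gamma> * - 1 = 0"
    using three_le_intersection_mult_iff[OF two \<open>a \<noteq> 0\<close> \<open>a \<noteq> d\<close>, of \<alpha> \<beta> \<gamma>]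
    unfolding passes_through_required_conic_form by (auto simp: conic_form_through)
qed simp_all

end

section \<open>Return from affine to homogeneous coordinates\<close>

theorem theorem1:
  fixes a d X1 Y1 Z1 X2 Y2 Z2 :: "'a::field"
    and P1 P2 :: "('a \<times> 'a \<times> 'a) set"
  assumes "CHAR('a) \<noteq> 2"
    and "a \<noteq> 0" and "d \<noteq> 0" and "a \<noteq> d"
    and "P1 = proj_point X1 Y1 Z1" and "Z1 \<noteq> 0" and "on_curve P1 (edwards_curve a d)"
    and "P2 = proj_point X2 Y2 Z2" and "Z2 \<noteq> 0" and "on_curve P2 (edwards_curve a d)"
  shows "(\<exists>cZ2 cXY cXZ. conic_determined a d P1 P2 cZ2 cXY cXZ)
    \<and> (P1 \<noteq> P2 \<and> P1 \<noteq> Oprime \<and> P2 \<noteq> Oprime \<longrightarrow>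
        conic_determined a d P1 P2
          (X1 * X2 * (Y1 * Z2 - Y2 * Z1))
          (Z1 * Z2 * (X1 * Z2 - X2 * Z1 + X1 * Y2 - X2 * Y1))
          (X2 * Y2 * Z1\<^sup>2 - X1 * Y1 * Z2\<^sup>2 + Y1 * Y2 * (X2 * Z1 - X1 * Z2)))
    \<and> (P1 \<noteq> P2 \<and> P2 = Oprime \<longrightarrow>
        conic_determined a d P1 P2 (- X1) Z1 Z1)
    \<and> (P1 = P2 \<longrightarrow>
        conic_determined a d P1 P2
          (X1 * Z1 * (Z1 - Y1))
          (d * X1\<^sup>2 * Y1 - Z1 ^ 3)
          (Z1 * (Z1 * Y1 - a * X1\<^sup>2)))"
proof -
  have two: "(2::'a) \<noteq> 0"
  proof
    assume "(2::'a) = 0"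
    then have "of_nat 2 = (0::'a)" by simp
    then have "CHAR('a) dvd 2" by (simp only: of_nat_eq_0_iff_char_dvd)
    then have "CHAR('a) = 1 \<or> CHAR('a) = 2"
      using two_is_prime_nat by (auto simp: prime_nat_iff)
    with \<open>CHAR('a) \<noteq> 2\<close> show False by simp
  qed
  define x1 y1 x2 y2 where "x1 = X1 / Z1" and "y1 = Y1 / Z1" and "x2 = X2 / Z2" and "y2 = Y2 / Z2"
  have X: "X1 = Z1 * x1" "Y1 = Z1 * y1" "X2 = Z2 * x2" "Y2 = Z2 * y2"
    using \<open>Z1 \<noteq> 0\<close> \<open>Z2 \<noteq> 0\<close> by (simp_all add: x1_def y1_def x2_def y2_def)
  have P: "P1 = proj_point x1 y1 1" "P2 = proj_point x2 y2 1"
    using proj_point_scale[of Z1 x1 y1 1] proj_point_scale[of Z2 x2 y2 1] assms X by simp_all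
  have on1: "a * x1\<^sup>2 + y1\<^sup>2 = 1 + d * x1\<^sup>2 * y1\<^sup>2" and on2: "a * x2\<^sup>2 + y2\<^sup>2 = 1 + d * x2\<^sup>2 * y2\<^sup>2"
    using assms(7,10) unfolding P by (auto dest: on_curve_affine_edwards_curve)
  note hyps = two \<open>a \<noteq> 0\<close> \<open>a \<noteq> d\<close>
  have A: "conic_determined a d P1 P2
      (X1 * X2 * (Y1 * Z2 - Y2 * Z1))
      (Z1 * Z2 * (X1 * Z2 - X2 * Z1 + X1 * Y2 - X2 * Y1))
      (X2 * Y2 * Z1\<^sup>2 - X1 * Y1 * Z2\<^sup>2 + Y1 * Y2 * (X2 * Z1 - X1 * Z2))"
    if "P1 \<noteq> P2" "P1 \<noteq> Oprime" "P2 \<noteq> Oprime"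
  proof -
    have "conic_determined a d P1 P2 (x1 * x2 * (y1 - y2)) (x1 - x2 + x1 * y2 - x2 * y1)
        (x2 * y2 - x1 * y1 + y1 * y2 * (x2 - x1))"
      unfolding P using that by (intro conic_determined_distinct[OF hyps on1 on2]) (auto simp: P Oprime_def)
    \<comment> \<open>The homogeneous formulas have degree 2 in the coordinates of each
      point.\<close>
    from conic_determined_scale[OF this, of "Z1\<^sup>2 * Z2\<^sup>2"] \<open>Z1 \<noteq> 0\<close> \<open>Z2 \<noteq> 0\<close> show ?thesis
      by (simp add: X algebra_simps power2_eq_square)
  qed
  have B: "conic_determined a d P1 P2 (- X1) Z1 Z1" if "P1 \<noteq> P2" "P2 = Oprime"
  proof -
    have "conic_determined a d P1 P2 (- x1) 1 1"
      unfolding P(1) \<open>P2 = Oprime\<close> using that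
      by (intro conic_determined_Oprime[OF hyps on1]) (auto simp: P Oprime_def)
    from conic_determined_scale[OF this \<open>Z1 \<noteq> 0\<close>] show ?thesis by (simp add: X)
  qed
  have C: "conic_determined a d P1 P2 (X1 * Z1 * (Z1 - Y1)) (d * X1\<^sup>2 * Y1 - Z1 ^ 3)
      (Z1 * (Z1 * Y1 - a * X1\<^sup>2))" if "P1 = P2"
  proof -
    have "conic_determined a d P1 P1 (x1 * (1 - y1)) (d * x1\<^sup>2 * y1 - 1) (y1 - a * x1\<^sup>2)"
    proof (cases "P1 = Oprime")
      case True
      then have "x1 = 0" "y1 = - 1" by (simp_all add: P Oprime_eq_iff)
      with conic_determined_Oprime_Oprime[OF hyps] True show ?thesis by simp
    next
      case False
      then show ?thesis
        unfolding P(1) by (intro conic_determined_tangent[OF hyps on1]) (auto simp: Oprime_eq_iff)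
    qed
    \<comment> \<open>The doubling formulas are homogeneous of degree 3.\<close>
    from conic_determined_scale[OF this, of "Z1 ^ 3"] \<open>Z1 \<noteq> 0\<close> \<open>P1 = P2\<close> show ?thesis
      by (simp add: X algebra_simps power2_eq_square power3_eq_cube)
  qed
  \<comment> \<open>Existence in the one configuration without its own formula, O' as the first
    point only, follows by symmetry.\<close>
  have "conic_determined a d P2 P1 (- x2) 1 1" if "P1 \<noteq> P2" "P1 = Oprime"
    unfolding P(2) \<open>P1 = Oprime\<close> using that
    by (intro conic_determined_Oprime[OF hyps on2]) (auto simp: P Oprime_def)
  with A B C conic_determined_commute show ?thesis by blast
qed

end
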